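(* Let $(a_n)_{n\ge1}$ and $(b_n)_{n\ge0}$ be sequences of numbers such that the continued fraction $b_0+\cfrac{a_1}{b_1+\cfrac{a_2}{b_2+\ddots}}$ converges. Then the continued fractions on the right-hand sides below converge and the following two identities hold: $$-\left(b_0+\cfrac{a_1}{b_1+\cfrac{a_2}{b_2+\cfrac{a_3}{b_3+\cfrac{a_4}{b_4+\ddots}}}}\right)=-b_0+\cfrac{a_1}{-b_1+\cfrac{a_2}{-b_2+\cfrac{a_3}{-b_3+\cfrac{a_4}{-b_4+\ddots}}}},$$ $$b_0+\cfrac{a_1}{b_1+\cfrac{a_2}{b_2+\cfrac{a_3}{b_3+\cfrac{a_4}{b_4+\ddots}}}}=b_0+\cfrac{-a_1}{-b_1+\cfrac{-a_2}{b_2+\cfrac{-a_3}{-b_3+\cfrac{-a_4}{b_4+\ddots}}}}.$$ In the first identity, the right-hand side has partial numerators $a_n$ ($n\ge1$) and partial denominators $-b_n$ ($n\ge0$). In the second, the right-hand side has partial numerators $-a_n$ ($n\ge1$) and partial denominators $(-1)^n b_n$ ($n\ge0$).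
   Context: For sequences of (real or complex) numbers $(a_n)_{n\ge1}$ and $(b_n)_{n\ge0}$, the $n$-th convergent $A_n/B_n$ of the (generalized) continued fraction $b_0+\cfrac{a_1}{b_1+\cfrac{a_2}{b_2+\ddots}}$ is its truncation at $a_n/b_n$. The sequences $(A_n)$, $(B_n)$ satisfy $A_n=b_nA_{n-1}+a_nA_{n-2}$ and $B_n=b_nB_{n-1}+a_nB_{n-2}$ for $n\ge1$, with $A_{-1}=1$, $A_0=b_0$, $B_{-1}=0$, $B_0=1$. The continued fraction converges, with value $x$, if $\lim_{n\to\infty}A_n/B_n=x$ (in particular $B_n\neq0$ for all sufficiently large $n$). The $a_n$ are called partial numerators and the $b_n$ partial denominators. *)

theory Defs
  imports "HOL-Analysis.Analysis"
begin

text \<open>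
  Continued fractions with partial numerators \<open>a n\<close> for \<open>n \<ge> 1\<close> (the entry \<open>a 0\<close> is never used)
  and partial denominators \<open>b n\<close> for \<open>n \<ge> 0\<close>.  The canonical numerators \<open>A\<close> and denominators
  \<open>B\<close> obey \<open>X\<^sub>n = b\<^sub>n X\<^sub>n\<^sub>-\<^sub>1 + a\<^sub>n X\<^sub>n\<^sub>-\<^sub>2\<close> for \<open>n \<ge> 1\<close>.  The values at index \<open>-1\<close>, which are \<open>1\<close> for
  \<open>A\<close> and \<open>0\<close> for \<open>B\<close>, are inlined in the equations for index \<open>1\<close>.

  Besides the real and the complex numbers, the class \<open>real_normed_field\<close> has no instances up
  to isomorphism (Gelfand--Mazur).
\<close>

fun cf_num :: "(nat \<Rightarrow> 'a::real_normed_field) \<Rightarrow> (nat \<Rightarrow> 'a) \<Rightarrow> nat \<Rightarrow> 'a" where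
  "cf_num a b 0 = b 0"
| "cf_num a b (Suc 0) = b 1 * b 0 + a 1 * 1"
| "cf_num a b (Suc (Suc n)) =
     b (Suc (Suc n)) * cf_num a b (Suc n) + a (Suc (Suc n)) * cf_num a b n"

fun cf_denom :: "(nat \<Rightarrow> 'a::real_normed_field) \<Rightarrow> (nat \<Rightarrow> 'a) \<Rightarrow> nat \<Rightarrow> 'a" where
  "cf_denom a b 0 = 1"
| "cf_denom a b (Suc 0) = b 1 * 1 + a 1 * 0"
| "cf_denom a b (Suc (Suc n)) =
     b (Suc (Suc n)) * cf_denom a b (Suc n) + a (Suc (Suc n)) * cf_denom a b n"

text \<open>
  Non-vanishing of the denominators has to be required explicitly, because division by zero
  yields zero.
\<close>

definition has_cf_value ::
    "(nat \<Rightarrow> 'a::real_normed_field) \<Rightarrow> (nat \<Rightarrow> 'a) \<Rightarrow> 'a \<Rightarrow> bool" where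
  "has_cf_value a b x \<longleftrightarrow>
     (\<forall>\<^sub>F n in sequentially. cf_denom a b n \<noteq> 0) \<and>
     (\<lambda>n. cf_num a b n / cf_denom a b n) \<longlonglongrightarrow> x"

definition cf_convergent ::
    "(nat \<Rightarrow> 'a::real_normed_field) \<Rightarrow> (nat \<Rightarrow> 'a) \<Rightarrow> bool" where
  "cf_convergent a b \<longleftrightarrow> (\<exists>x. has_cf_value a b x)"

definition cf_value ::
    "(nat \<Rightarrow> 'a::real_normed_field) \<Rightarrow> (nat \<Rightarrow> 'a) \<Rightarrow> 'a" where
  "cf_value a b = (THE x. has_cf_value a b x)"

lemma cf_value_eq: "has_cf_value a b x \<Longrightarrow> cf_value a b = x"
  unfolding cf_value_def
  by (rule the_equality) (auto simp: has_cf_value_def intro: LIMSEQ_unique)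

end

theory Submission
  imports Defs
begin

text \<open>
  Both identities are equivalence transformations.  Multiplying numerator and denominator of the
  \<open>n\<close>-th nested fraction by \<open>c\<^sub>n\<close> turns \<open>a\<^sub>n\<close> into \<open>c\<^sub>n\<^sub>-\<^sub>1 c\<^sub>n a\<^sub>n\<close> and \<open>b\<^sub>n\<close> into \<open>c\<^sub>n b\<^sub>n\<close>; allowing
  \<open>c\<^sub>0 \<noteq> 1\<close> also multiplies the whole continued fraction by \<open>c\<^sub>0\<close>.  On the level of convergents, the
  recurrences show that \<open>B\<^sub>n\<close> picks up the factor \<open>c\<^sub>1 \<cdots> c\<^sub>n\<close> and \<open>A\<^sub>n\<close> the factor
  \<open>c\<^sub>0 c\<^sub>1 \<cdots> c\<^sub>n\<close>.  With all \<open>c\<^sub>n\<close> nonzero, the vanishing of denominators is thus unaffected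
  and every convergent is multiplied by \<open>c\<^sub>0\<close>.

  The first identity is the case \<open>c\<^sub>n = -1\<close>, where \<open>c\<^sub>n\<^sub>-\<^sub>1 c\<^sub>n = 1\<close> and \<open>c\<^sub>0 = -1\<close>; the second is the
  case \<open>c\<^sub>n = (-1)\<^sup>n\<close>, where \<open>c\<^sub>n\<^sub>-\<^sub>1 c\<^sub>n = -1\<close> and \<open>c\<^sub>0 = 1\<close>.
\<close>

lemma cf_denom_scale:
  fixes a b a' b' c :: "nat \<Rightarrow> 'a::real_normed_field"
  assumes "\<And>n. a' (Suc n) = c n * c (Suc n) * a (Suc n)" and "\<And>n. b' n = c n * b n"
  shows "cf_denom a' b' n = (\<Prod>k=1..n. c k) * cf_denom a b n"
  by (induction n rule: induct_nat_012) (simp_all add: assms algebra_simps)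

lemma cf_num_scale:
  fixes a b a' b' c :: "nat \<Rightarrow> 'a::real_normed_field"
  assumes "\<And>n. a' (Suc n) = c n * c (Suc n) * a (Suc n)" and "\<And>n. b' n = c n * b n"
  shows "cf_num a' b' n = c 0 * (\<Prod>k=1..n. c k) * cf_num a b n"
  by (induction n rule: induct_nat_012) (simp_all add: assms algebra_simps)

lemma has_cf_value_scale:
  fixes a b a' b' c :: "nat \<Rightarrow> 'a::real_normed_field"
  assumes val: "has_cf_value a b x"
    and nz: "\<And>n. c n \<noteq> 0"
    and a': "\<And>n. a' (Suc n) = c n * c (Suc n) * a (Suc n)" and b': "\<And>n. b' n = c n * b n"
  shows "has_cf_value a' b' (c 0 * x)"
proof -
  have denom: "cf_denom a' b' n = (\<Prod>k=1..n. c k) * cf_denom a b n" for n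
    using a' b' by (rule cf_denom_scale)
  have num: "cf_num a' b' n = c 0 * (\<Prod>k=1..n. c k) * cf_num a b n" for n
    using a' b' by (rule cf_num_scale)
  have prod_nz: "(\<Prod>k=1..n. c k) \<noteq> 0" for n
    using nz by simp
  have "cf_num a' b' n / cf_denom a' b' n = c 0 * (cf_num a b n / cf_denom a b n)" for n
    using prod_nz[of n]
    by (simp add: num denom mult.left_commute)
  moreover have "cf_denom a' b' n \<noteq> 0 \<longleftrightarrow> cf_denom a b n \<noteq> 0" for n
    using prod_nz[of n] by (simp add: denom)
  ultimately show ?thesis
    using val unfolding has_cf_value_def by (simp only: tendsto_mult_left)
qed

theorem theorem3:
  fixes a b :: "nat \<Rightarrow> 'a::real_normed_field"
  assumes "cf_convergent a b"
  shows "cf_convergent a (\<lambda>n. - b n) \<and>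
         - cf_value a b = cf_value a (\<lambda>n. - b n) \<and>
         cf_convergent (\<lambda>n. - a n) (\<lambda>n. (- 1) ^ n * b n) \<and>
         cf_value a b = cf_value (\<lambda>n. - a n) (\<lambda>n. (- 1) ^ n * b n)"
proof -
  obtain x where x: "has_cf_value a b x"
    using assms unfolding cf_convergent_def by blast
  have neg: "has_cf_value a (\<lambda>n. - b n) (- x)"
    using has_cf_value_scale[OF x, of "\<lambda>_. - 1" a "\<lambda>n. - b n"] by simp
  have alt: "has_cf_value (\<lambda>n. - a n) (\<lambda>n. (- 1) ^ n * b n) x"
    using has_cf_value_scale[OF x, of "\<lambda>n. (- 1) ^ n" "\<lambda>n. - a n" "\<lambda>n. (- 1) ^ n * b n"]
    by (simp flip: power_add)
  show ?thesis
    using neg alt cf_value_eq[OF x] cf_value_eq[OF neg] cf_value_eq[OF alt]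
    unfolding cf_convergent_def by auto
qed

end
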